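(* Let $d\geq 2$ and let $S=(V,\mathcal{H})$ be a paving simplicial complex of dimension $d$. Then the following are equivalent: (i) $S\in\mathrm{TBPav}(d)$; (ii) there exists a nonempty family $\mathcal{L}\subseteq P_{\geq d}(V)\setminus\{V\}$ such that $\mathcal{H}=\bigcup_{L\in\mathcal{L}}\mathcal{B}_d(V,L)$, where $\mathcal{B}_d(V,L)=P_{\leq d}(V)\cup\{X\in P_{d+1}(V) : |X\cap L|=d\}$.
   Context: A (finite) simplicial complex is a pair $S=(V,\mathcal{H})$ where $V$ is a finite nonempty set and $\mathcal{H}\subseteq 2^V$ contains all singletons and is closed under taking subsets. Its rank is $\max\{|I| : I\in\mathcal{H}\}$ and its dimension is rank minus one. $P_n(V)$ (resp. $P_{\leq n}(V)$, $P_{\geq n}(V)$) denotes the set of subsets of $V$ with exactly (resp. at most, at least) $n$ elements. $S$ is paving if $P_{\dim S}(V)\subseteq \mathcal{H}$. A flat of $S$ is a set $X\subseteq V$ such that $I\cup\{p\}\in\mathcal{H}$ for all $I\in\mathcal{H}\cap 2^X$ and $p\in V\setminus X$. Given a chain $F_0\subset\cdots\subset F_k$ of subsets of $V$, $X$ is a transversal of its successive differences if $X$ has an enumeration $x_1,\dots,x_k$ with $x_i\in F_i\setminus F_{i-1}$. $S$ is boolean representable (BRSC) if there is a boolean matrix $M$ with columns indexed by $V$ such that $\mathcal{H}$ is exactly the set of $X\subseteq V$ for which some square submatrix with column set $X$ is congruent (by permuting rows and columns) to a lower unitriangular boolean matrix; equivalently, $\mathcal{H}$ is the set of transversals of successive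 differences of chains of flats of $S$. For $k\geq1$, $T_k(S)=(V,\mathcal{H}\cap P_{\leq k}(V))$. $S$ is a TBRSC if $S=T_k(S')$ for some BRSC $S'$ and $k\geq 1$. $\mathrm{TBPav}(d)$ is the class of paving TBRSCs of dimension $d$. *)

theory Defs imports Main
begin

definition P_eq :: "nat \<Rightarrow> 'a set \<Rightarrow> 'a set set" where
  "P_eq n V = {X. X \<subseteq> V \<and> card X = n}"

definition P_le :: "nat \<Rightarrow> 'a set \<Rightarrow> 'a set set" where
  "P_le n V = {X. X \<subseteq> V \<and> card X \<le> n}"

definition P_ge :: "nat \<Rightarrow> 'a set \<Rightarrow> 'a set set" where
  "P_ge n V = {X. X \<subseteq> V \<and> card X \<ge> n}"

type_synonym 'a set_system = "'a set \<times> 'a set set"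

fun simplicial_complex :: "'a set_system \<Rightarrow> bool" where
  "simplicial_complex (V, H) \<longleftrightarrow>
     finite V \<and> V \<noteq> {} \<and> H \<subseteq> Pow V \<and> (\<forall>v\<in>V. {v} \<in> H) \<and>
     (\<forall>I\<in>H. \<forall>J. J \<subseteq> I \<longrightarrow> J \<in> H)"

fun sc_rank :: "'a set_system \<Rightarrow> nat" where
  "sc_rank (V, H) = Max (card ` H)"

(* A simplicial complex has rank at least 1, so the subtraction does not truncate. *)
definition sc_dim :: "'a set_system \<Rightarrow> nat" where
  "sc_dim S = sc_rank S - 1"

fun paving :: "'a set_system \<Rightarrow> bool" where
  "paving (V, H) \<longleftrightarrow> P_eq (sc_dim (V, H)) V \<subseteq> H"

(* An n x n boolean matrix; only the entries with both indices below n matter. *)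
definition lower_unitriangular :: "nat \<Rightarrow> (nat \<Rightarrow> nat \<Rightarrow> bool) \<Rightarrow> bool" where
  "lower_unitriangular n A \<longleftrightarrow>
     (\<forall>i<n. A i i) \<and> (\<forall>i<n. \<forall>j<n. i < j \<longrightarrow> \<not> A i j)"

(* The submatrix of M with row set Y and column set X is square and congruent to a
   lower unitriangular matrix: r and c are the orderings of its rows and columns. *)
definition congruent_unitriangular :: "('r \<Rightarrow> 'a \<Rightarrow> bool) \<Rightarrow> 'r set \<Rightarrow> 'a set \<Rightarrow> bool" where
  "congruent_unitriangular M Y X \<longleftrightarrow>
     (\<exists>n r c. bij_betw r {..<n} Y \<and> bij_betw c {..<n} X \<and>
        lower_unitriangular n (\<lambda>i j. M (r i) (c j)))"

(* M has rows indexed by {..<m} and columns indexed by V. *)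
fun boolean_representable :: "'a set_system \<Rightarrow> bool" where
  "boolean_representable (V, H) \<longleftrightarrow>
     (\<exists>(m::nat) (M :: nat \<Rightarrow> 'a \<Rightarrow> bool).
        H = {X. X \<subseteq> V \<and> (\<exists>Y \<subseteq> {..<m}. congruent_unitriangular M Y X)})"

definition BRSC :: "'a set_system \<Rightarrow> bool" where
  "BRSC S \<longleftrightarrow> simplicial_complex S \<and> boolean_representable S"

fun truncation :: "nat \<Rightarrow> 'a set_system \<Rightarrow> 'a set_system" where
  "truncation k (V, H) = (V, H \<inter> P_le k V)"

definition TBRSC :: "'a set_system \<Rightarrow> bool" where
  "TBRSC S \<longleftrightarrow> (\<exists>S' k. BRSC S' \<and> k \<ge> 1 \<and> S = truncation k S')"

definition TBPav :: "nat \<Rightarrow> 'a set_system set" where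
  "TBPav d = {S. simplicial_complex S \<and> TBRSC S \<and> paving S \<and> sc_dim S = d}"

definition Bd :: "nat \<Rightarrow> 'a set \<Rightarrow> 'a set \<Rightarrow> 'a set set" where
  "Bd d V L = P_le d V \<union> {X \<in> P_eq (d + 1) V. card (X \<inter> L) = d}"

end

(* Both directions rest on one observation: in a triangular arrangement of a column set X, the
   top row has its 1 in one column x of X and is 0 on X - {x}, so its zero set meets X in
   |X| - 1 elements.
   If S is the truncation of the complex of a matrix, the family consists of the zero sets of
   the rows: every d-subset is independent, so it can be extended by a row vanishing on it.
   Conversely, take the matrix whose rows have as zero sets the members of the family and all
   subsets of size less than d. The small zero sets make all d-subsets independent, and are too
   small for the top row of a (d+1)-set. *)
theory Submission imports Defs
begin

section \<open>Adding and removing the top row of a triangular arrangement\<close>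

lemma congruent_unitriangular_empty: "congruent_unitriangular M {} {}"
  unfolding congruent_unitriangular_def lower_unitriangular_def
  by (rule exI[of _ 0]) (simp add: bij_betw_def)

lemma congruent_unitriangular_finite:
  assumes "congruent_unitriangular M Y X"
  shows "finite X"
  using assms unfolding congruent_unitriangular_def
  by (metis bij_betw_finite finite_lessThan)

text \<open>Moves an enumeration up one place to make room for a new first element; used to put a
  row or a column in front.\<close>

lemma bij_betw_case_nat:
  assumes "bij_betw f {..<n} A" and "a \<notin> A"
  shows "bij_betw (case_nat a f) {..<Suc n} (insert a A)"
proof -
  have "bij_betw (case_nat a f) (Suc ` {..<n}) A"
    using assms(1) by (simp add: bij_betw_def inj_on_def image_image)
  moreover have "bij_betw (case_nat a f) {0} {a}"
    by (simp add: bij_betw_def)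
  ultimately have "bij_betw (case_nat a f) ({0} \<union> Suc ` {..<n}) ({a} \<union> A)"
    using assms(2) by (intro bij_betw_combine) auto
  then show ?thesis
    by (simp add: lessThan_Suc_eq_insert_0)
qed

lemma bij_betw_shift:
  assumes "bij_betw f {..<Suc n} A"
  shows "bij_betw (\<lambda>i. f (Suc i)) {..<n} (A - {f 0})"
proof -
  have A: "A = insert (f 0) ((\<lambda>i. f (Suc i)) ` {..<n})" and inj: "inj_on f {..<Suc n}"
    using assms by (simp_all add: bij_betw_def lessThan_Suc_eq_insert_0 image_image)
  have "f 0 \<notin> (\<lambda>i. f (Suc i)) ` {..<n}"
    using inj by (auto simp: inj_on_def)
  moreover have "inj_on (\<lambda>i. f (Suc i)) {..<n}"
    using inj by (auto simp: inj_on_def)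
  ultimately show ?thesis
    using A by (simp add: bij_betw_def)
qed

text \<open>Put \<open>y\<close> and \<open>x\<close> at index 0: the only new constraints are the
  diagonal 1 and the zeros to its right, which are the hypotheses on \<open>y\<close>. The entries
  below the diagonal in column \<open>x\<close> are free.\<close>

lemma congruent_unitriangular_insert:
  assumes "congruent_unitriangular M Y X" and "M y x" and zero: "\<And>z. z \<in> X \<Longrightarrow> \<not> M y z"
  shows "congruent_unitriangular M (insert y Y) (insert x X)"
proof -
  obtain n r c where r: "bij_betw r {..<n} Y" and c: "bij_betw c {..<n} X"
    and tri: "lower_unitriangular n (\<lambda>i j. M (r i) (c j))"
    using assms(1) unfolding congruent_unitriangular_def by blast
  have cX: "c i \<in> X" if "i < n" for i
    using c that by (auto simp: bij_betw_def)
  have "x \<notin> X"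
    using assms(2) zero by blast
  \<comment> \<open>Each row of \<open>Y\<close> has its diagonal 1 in a column of \<open>X\<close>,
    where row \<open>y\<close> vanishes.\<close>
  moreover have "y \<notin> Y"
    using r tri cX zero by (auto simp: bij_betw_def lower_unitriangular_def)
  moreover have "lower_unitriangular (Suc n) (\<lambda>i j. M (case_nat y r i) (case_nat x c j))"
    using tri assms(2) zero cX
    by (auto simp: lower_unitriangular_def split: nat.split)
  ultimately show ?thesis
    using bij_betw_case_nat[OF r] bij_betw_case_nat[OF c]
    unfolding congruent_unitriangular_def by blast
qed

text \<open>Inverse of the insertion: \<open>y\<close> and \<open>x\<close> are the row and the
  column at index 0, and deleting both keeps the rest triangular.\<close>

lemma congruent_unitriangular_top_row:
  assumes "congruent_unitriangular M Y X" and "X \<noteq> {}"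
  obtains y x where "y \<in> Y" "x \<in> X" "M y x" "\<And>z. z \<in> X - {x} \<Longrightarrow> \<not> M y z"
    "congruent_unitriangular M (Y - {y}) (X - {x})"
proof -
  obtain n r c where r: "bij_betw r {..<n} Y" and c: "bij_betw c {..<n} X"
    and tri: "lower_unitriangular n (\<lambda>i j. M (r i) (c j))"
    using assms(1) unfolding congruent_unitriangular_def by blast
  obtain m where n: "n = Suc m"
    using c assms(2) by (cases n) (auto simp: bij_betw_def)
  have r': "bij_betw (\<lambda>i. r (Suc i)) {..<m} (Y - {r 0})"
    and c': "bij_betw (\<lambda>i. c (Suc i)) {..<m} (X - {c 0})"
    using r c n bij_betw_shift by blast+
  have "lower_unitriangular m (\<lambda>i j. M (r (Suc i)) (c (Suc j)))"
    using tri n by (auto simp: lower_unitriangular_def)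
  then have cong: "congruent_unitriangular M (Y - {r 0}) (X - {c 0})"
    using r' c' unfolding congruent_unitriangular_def by blast
  have "r 0 \<in> Y" "c 0 \<in> X" "M (r 0) (c 0)"
    using r c tri n by (auto simp: bij_betw_def lower_unitriangular_def)
  moreover have "\<not> M (r 0) z" if z: "z \<in> X - {c 0}" for z
  proof -
    obtain i where "i < m" "z = c (Suc i)"
      using c' z by (auto simp: bij_betw_def)
    then show ?thesis
      using tri n by (simp add: lower_unitriangular_def)
  qed
  ultimately show ?thesis
    using cong that by blast
qed

text \<open>Peel off the top row \<open>y\<close> with its column \<open>x\<close> and recurse. The
  pair is put back on top if \<open>x\<close> survives in the subset and dropped otherwise.\<close>

lemma congruent_unitriangular_subset:
  assumes "congruent_unitriangular M Y X" and "X' \<subseteq> X"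
  shows "\<exists>Y'\<subseteq>Y. congruent_unitriangular M Y' X'"
  using assms
proof (induction "card X" arbitrary: X X' Y)
  case 0
  then have "X' = {}"
    using congruent_unitriangular_finite[OF "0.prems"(1)] by simp
  then show ?case
    using congruent_unitriangular_empty by blast
next
  case (Suc n)
  from Suc.hyps(2) have "X \<noteq> {}" by auto
  with Suc.prems(1) obtain y x where yx: "y \<in> Y" "x \<in> X" "M y x" "\<And>z. z \<in> X - {x} \<Longrightarrow> \<not> M y z"
    "congruent_unitriangular M (Y - {y}) (X - {x})"
    using congruent_unitriangular_top_row by metis
  have "n = card (X - {x})"
    using Suc.hyps(2) yx(2) by simp
  moreover have sub: "X' - {x} \<subseteq> X - {x}"
    using Suc.prems(2) by blast
  ultimately obtain Y' where Y': "Y' \<subseteq> Y - {y}" "congruent_unitriangular M Y' (X' - {x})"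
    using Suc.hyps(1) yx(5) by blast
  show ?case
  proof (cases "x \<in> X'")
    case True
    have "congruent_unitriangular M (insert y Y') (insert x (X' - {x}))"
      using Y'(2) yx(3,4) sub by (intro congruent_unitriangular_insert) auto
    moreover have "insert y Y' \<subseteq> Y"
      using Y'(1) yx(1) by blast
    ultimately show ?thesis
      using True by (metis insert_Diff)
  next
    case False
    then show ?thesis
      using Y' by (metis Diff_empty Diff_insert0 Diff_subset subset_trans)
  qed
qed

section \<open>Face sizes in a paving complex\<close>

text \<open>Leaves only the sets of size \<open>d + 1\<close> undetermined, so both directions need
  to compare only those.\<close>

lemma paving_complex_bounds:
  assumes "simplicial_complex (V, H)" and "paving (V, H)" and "sc_dim (V, H) = d" and "d > 0"
  shows "P_le d V \<subseteq> H" and "H \<subseteq> P_le (d + 1) V" and "\<exists>X\<in>H. card X = d + 1"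
proof -
  have V: "finite V" "V \<noteq> {}" "H \<subseteq> Pow V" and sing: "\<And>v. v \<in> V \<Longrightarrow> {v} \<in> H"
    and down: "\<And>I J. I \<in> H \<Longrightarrow> J \<subseteq> I \<Longrightarrow> J \<in> H"
    using assms(1) by auto
  have fin: "finite (card ` H)"
    using V by (meson finite_Pow_iff finite_imageI finite_subset)
  have ne: "card ` H \<noteq> {}"
    using V(2) sing by auto
  \<comment> \<open>Positivity of \<open>d\<close> rules out truncation in the subtraction that
    defines the dimension.\<close>
  have rank: "Max (card ` H) = d + 1"
    using assms(3,4) by (simp add: sc_dim_def)
  show ex: "\<exists>X\<in>H. card X = d + 1"
    using Max_in[OF fin ne] rank by force
  have "card X \<le> d + 1" if "X \<in> H" for X
    using Max_ge[OF fin] rank that by force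
  then show "H \<subseteq> P_le (d + 1) V"
    using V(3) by (auto simp: P_le_def)
  \<comment> \<open>Ensures that any set of at most \<open>d\<close> points can be enlarged to
    exactly \<open>d\<close> points, where paving applies.\<close>
  have "d \<le> card V"
    using ex V by (metis PowD card_mono le_add1 le_trans subsetD)
  show "P_le d V \<subseteq> H"
  proof
    fix X assume "X \<in> P_le d V"
    then obtain B where "X \<subseteq> B" "B \<subseteq> V" "card B = d"
      using exists_subset_between[of X d V] \<open>d \<le> card V\<close> V(1) by (auto simp: P_le_def)
    moreover have "P_eq d V \<subseteq> H"
      using assms(2,3) by simp
    ultimately have "B \<in> H"
      by (auto simp: P_eq_def)
    then show "X \<in> H"
      using down \<open>X \<subseteq> B\<close> by blast
  qed
qed

section \<open>From a boolean matrix to a family\<close>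

lemma truncation_family:
  assumes "finite V" and "P_le d V \<subseteq> H" and "H \<subseteq> P_le (d + 1) V" and "\<exists>X\<in>H. card X = d + 1"
    and "boolean_representable (V, H')" and "H = H' \<inter> P_le k V"
  shows "\<exists>\<L>. \<L> \<noteq> {} \<and> \<L> \<subseteq> P_ge d V - {V} \<and> H = (\<Union>L\<in>\<L>. Bd d V L)"
proof -
  obtain m :: nat and M
    where H': "H' = {X. X \<subseteq> V \<and> (\<exists>Y\<subseteq>{..<m}. congruent_unitriangular M Y X)}"
    using assms(5) unfolding boolean_representable.simps by blast
  define zeros where "zeros r = {v \<in> V. \<not> M r v}" for r
  \<comment> \<open>The discarded zero sets cannot belong to the top row of a set of size
    \<open>d + 1\<close>: they have fewer than \<open>d\<close> points or come from a row without
    any 1.\<close>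
  define \<L> where "\<L> = (zeros ` {..<m} \<inter> P_ge d V) - {V}"
  \<comment> \<open>Some face of size \<open>d + 1\<close> survived the truncation, so the
    truncation removes no set of that size.\<close>
  have k: "d + 1 \<le> k"
    using assms(4,6) by (auto simp: P_le_def)
  have upper: "\<exists>L\<in>\<L>. X \<in> Bd d V L" if X: "X \<in> H" "card X = d + 1" for X
  proof -
    obtain Y where Y: "Y \<subseteq> {..<m}" "congruent_unitriangular M Y X"
      using X(1) assms(6) H' by blast
    have XV: "X \<subseteq> V"
      using X(1) assms(3) by (auto simp: P_le_def)
    have "X \<noteq> {}"
      using X(2) by auto
    with Y(2) obtain r x where r: "r \<in> Y" "x \<in> X" "M r x" "\<And>z. z \<in> X - {x} \<Longrightarrow> \<not> M r z"
      by (metis congruent_unitriangular_top_row)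
    have "X \<inter> zeros r = X - {x}"
      using r XV by (auto simp: zeros_def)
    then have card: "card (X \<inter> zeros r) = d"
      using r(2) X(2) by simp
    have "finite (zeros r)"
      using assms(1) by (simp add: zeros_def)
    then have "d \<le> card (zeros r)"
      using card by (metis card_mono inf_le2)
    moreover have "zeros r \<noteq> V"
      using r(2,3) XV by (auto simp: zeros_def)
    ultimately have "zeros r \<in> \<L>"
      using r(1) Y(1) by (auto simp: \<L>_def P_ge_def zeros_def)
    then show ?thesis
      using card XV X(2) by (auto simp: Bd_def P_eq_def)
  qed
  have lower: "X \<in> H" if X: "L \<in> \<L>" "X \<subseteq> V" "card X = d + 1" "card (X \<inter> L) = d" for L X
  proof -
    obtain r where r: "r < m" "L = zeros r"
      using X(1) by (auto simp: \<L>_def)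
    have fX: "finite X"
      using X(2) assms(1) finite_subset by blast
    have "card (X - L) = 1"
      using card_Diff_subset_Int[of X L] fX X(3,4) by simp
    then obtain x where x: "X - L = {x}"
      using card_1_singletonE by blast
    \<comment> \<open>These \<open>d\<close> points have a triangular arrangement by paving. Row
      \<open>r\<close> vanishes on them and is 1 at \<open>x\<close>, so it goes on top.\<close>
    have "X \<inter> L \<in> H"
      using X(2,4) assms(2) by (auto simp: P_le_def)
    then obtain Y where Y: "Y \<subseteq> {..<m}" "congruent_unitriangular M Y (X \<inter> L)"
      using assms(6) H' by blast
    have "M r x"
      using x X(2) r(2) by (auto simp: zeros_def)
    then have "congruent_unitriangular M (insert r Y) (insert x (X \<inter> L))"
      using Y(2) r(2) by (intro congruent_unitriangular_insert) (auto simp: zeros_def)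
    moreover have "insert x (X \<inter> L) = X"
      using x by blast
    moreover have "insert r Y \<subseteq> {..<m}"
      using Y(1) r(1) by simp
    ultimately have "\<exists>Y\<subseteq>{..<m}. congruent_unitriangular M Y X"
      by metis
    then have "X \<in> H'"
      using H' X(2) by simp
    then show ?thesis
      using assms(6) X(2,3) k by (simp add: P_le_def)
  qed
  have ne: "\<L> \<noteq> {}"
    using assms(4) upper by blast
  have "H = (\<Union>L\<in>\<L>. Bd d V L)"
  proof
    show "H \<subseteq> (\<Union>L\<in>\<L>. Bd d V L)"
    proof
      fix X assume X: "X \<in> H"
      then have "X \<in> P_le d V \<or> card X = d + 1"
        using assms(3) by (auto simp: P_le_def)
      then show "X \<in> (\<Union>L\<in>\<L>. Bd d V L)"
        using upper X ne by (auto simp: Bd_def)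
    qed
    show "(\<Union>L\<in>\<L>. Bd d V L) \<subseteq> H"
      using lower assms(2) by (auto simp: Bd_def P_eq_def)
  qed
  moreover have "\<L> \<subseteq> P_ge d V - {V}"
    by (auto simp: \<L>_def)
  ultimately show ?thesis
    using ne by blast
qed

section \<open>From a family to a boolean matrix\<close>

lemma BRSC_of_family:
  assumes "finite V" and "V \<noteq> {}" and "d > 0" and ne: "\<L> \<noteq> {}" and \<L>: "\<L> \<subseteq> P_ge d V"
  shows "\<exists>H'. BRSC (V, H') \<and> (\<Union>L\<in>\<L>. Bd d V L) = H' \<inter> P_le (d + 1) V"
proof -
  define F where "F = \<L> \<union> P_le (d - 1) V"
  have "F \<subseteq> Pow V"
    using \<L> by (auto simp: F_def P_le_def P_ge_def)
  then have "finite F"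
    using assms(1) by (meson finite_Pow_iff finite_subset)
  then obtain m :: nat and Z where "bij_betw Z {0..<m} F"
    using ex_bij_betw_nat_finite by blast
  then have Z: "Z ` {..<m} = F"
    by (simp add: bij_betw_def atLeast0LessThan)
  define M where "M = (\<lambda>i v. v \<notin> Z i)"
  define H' where "H' = {X. X \<subseteq> V \<and> (\<exists>Y\<subseteq>{..<m}. congruent_unitriangular M Y X)}"
  have fin: "finite X" if "X \<subseteq> V" for X
    using that assms(1) finite_subset by blast
  \<comment> \<open>The row with zero set \<open>A\<close> becomes the top row.\<close>
  have extend: "insert x X \<in> H'" if "X \<in> H'" "A \<in> F" "x \<in> V" "x \<notin> A" "X \<subseteq> A" for x X A
  proof -
    obtain Y where Y: "Y \<subseteq> {..<m}" "congruent_unitriangular M Y X"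
      using \<open>X \<in> H'\<close> by (auto simp: H'_def)
    obtain i where i: "i < m" "A = Z i"
      using \<open>A \<in> F\<close> Z by auto
    have "congruent_unitriangular M (insert i Y) (insert x X)"
      using Y(2) that i by (intro congruent_unitriangular_insert) (auto simp: M_def)
    moreover have "insert i Y \<subseteq> {..<m}" "insert x X \<subseteq> V"
      using Y(1) i(1) that by (auto simp: H'_def)
    ultimately show ?thesis
      unfolding H'_def by blast
  qed
  \<comment> \<open>Points are added one at a time. Before each addition the set has at most
    \<open>d - 1\<close> points, so it is itself the zero set of a row.\<close>
  have small: "X \<in> H'" if "X \<subseteq> V" "card X \<le> d" for X
    using fin[OF that(1)] that
  proof (induction X rule: finite_induct)
    case empty
    then show ?case
      using congruent_unitriangular_empty by (auto simp: H'_def)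
  next
    case (insert x X)
    moreover from insert have "X \<in> F"
      by (auto simp: F_def P_le_def)
    ultimately show ?case
      using extend[of X X x] by simp
  qed
  have "{v} \<in> H'" if "v \<in> V" for v
    using small[of "{v}"] that assms(3) by simp
  moreover have "J \<in> H'" if "I \<in> H'" "J \<subseteq> I" for I J
  proof -
    obtain Y where Y: "Y \<subseteq> {..<m}" "congruent_unitriangular M Y I"
      using \<open>I \<in> H'\<close> by (auto simp: H'_def)
    obtain Y' where "Y' \<subseteq> Y" "congruent_unitriangular M Y' J"
      using congruent_unitriangular_subset[OF Y(2) \<open>J \<subseteq> I\<close>] by blast
    then show ?thesis
      using that Y(1) unfolding H'_def by blast
  qed
  moreover have "H' \<subseteq> Pow V"
    by (auto simp: H'_def)
  ultimately have "simplicial_complex (V, H')"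
    using assms(1,2) by simp
  moreover have "boolean_representable (V, H')"
    unfolding boolean_representable.simps H'_def by blast
  ultimately have "BRSC (V, H')"
    by (simp add: BRSC_def)
  moreover have "(\<Union>L\<in>\<L>. Bd d V L) \<subseteq> H' \<inter> P_le (d + 1) V"
  proof
    fix X assume "X \<in> (\<Union>L\<in>\<L>. Bd d V L)"
    then obtain L where L: "L \<in> \<L>" "X \<in> Bd d V L"
      by blast
    show "X \<in> H' \<inter> P_le (d + 1) V"
    proof (cases "X \<in> P_le d V")
      case True
      then show ?thesis
        using small by (auto simp: P_le_def)
    next
      case False
      then have X: "X \<subseteq> V" "card X = d + 1" "card (X \<inter> L) = d"
        using L(2) by (auto simp: Bd_def P_eq_def)
      then have "card (X - L) = 1"
        using card_Diff_subset_Int[of X L] fin[OF X(1)] by simp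
      then obtain x where x: "X - L = {x}"
        using card_1_singletonE by blast
      have "X \<inter> L \<in> H'"
        using X by (intro small) auto
      then have "insert x (X \<inter> L) \<in> H'"
        using L(1) x X(1) by (intro extend[of _ L]) (auto simp: F_def)
      moreover have "insert x (X \<inter> L) = X"
        using x by blast
      ultimately show ?thesis
        using X by (simp add: P_le_def)
    qed
  qed
  moreover have "X \<in> (\<Union>L\<in>\<L>. Bd d V L)" if X: "X \<in> H'" "X \<in> P_le (d + 1) V" for X
  proof (cases "card X = d + 1")
    case True
    then have "X \<noteq> {}"
      by auto
    moreover obtain Y where Y: "Y \<subseteq> {..<m}" "congruent_unitriangular M Y X"
      using X(1) by (auto simp: H'_def)
    ultimately obtain i x where i: "i \<in> Y" "x \<in> X" "M i x" "\<And>z. z \<in> X - {x} \<Longrightarrow> \<not> M i z"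
      by (metis congruent_unitriangular_top_row)
    have "X \<inter> Z i = X - {x}"
      using i by (auto simp: M_def)
    then have card: "card (X \<inter> Z i) = d"
      using True i(2) by simp
    have "Z i \<in> F"
      using i(1) Y(1) Z by blast
    then have "card (X \<inter> Z i) \<le> card (Z i)"
      using \<open>F \<subseteq> Pow V\<close> fin by (intro card_mono) auto
    \<comment> \<open>\<open>Z i\<close> has at least \<open>d\<close> points, and
      \<open>d - 1 < d\<close> because \<open>d\<close> is positive.\<close>
    then have "Z i \<notin> P_le (d - 1) V"
      using card assms(3) by (auto simp: P_le_def)
    then have "Z i \<in> \<L>"
      using \<open>Z i \<in> F\<close> by (simp add: F_def)
    then show ?thesis
      using card True X(2) by (auto simp: Bd_def P_eq_def P_le_def)
  next
    case False
    then show ?thesis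
      \<comment> \<open>Any single member of the family already contributes all sets of size at most
        \<open>d\<close>.\<close>
      using X(2) ne by (auto simp: Bd_def P_le_def)
  qed
  ultimately show ?thesis
    by blast
qed

section \<open>The equivalence\<close>

theorem theorem5p6:
  fixes d :: nat and V :: "'a set" and H :: "'a set set"
  assumes "d \<ge> 2"
    and "simplicial_complex (V, H)"
    and "paving (V, H)"
    and "sc_dim (V, H) = d"
  shows "(V, H) \<in> TBPav d \<longleftrightarrow>
    (\<exists>\<L>. \<L> \<noteq> {} \<and> \<L> \<subseteq> P_ge d V - {V} \<and> H = (\<Union>L\<in>\<L>. Bd d V L))"
proof
  have V: "finite V" "V \<noteq> {}" and d: "d > 0"
    using assms(1,2) by auto
  {
    assume "(V, H) \<in> TBPav d"
    then obtain S' k where S': "BRSC S'" "(V, H) = truncation k S'"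
      unfolding TBPav_def TBRSC_def by blast
    obtain V' H' where "S' = (V', H')"
      by (cases S')
    moreover from this have "V' = V" "H = H' \<inter> P_le k V"
      using S'(2) by simp_all
    ultimately have "boolean_representable (V, H')" "H = H' \<inter> P_le k V"
      using S'(1) unfolding BRSC_def by blast+
    with V(1) paving_complex_bounds[OF assms(2-4) d]
    show "\<exists>\<L>. \<L> \<noteq> {} \<and> \<L> \<subseteq> P_ge d V - {V} \<and> H = (\<Union>L\<in>\<L>. Bd d V L)"
      by (rule truncation_family)
  next
    assume "\<exists>\<L>. \<L> \<noteq> {} \<and> \<L> \<subseteq> P_ge d V - {V} \<and> H = (\<Union>L\<in>\<L>. Bd d V L)"
    then obtain \<L> where \<L>: "\<L> \<noteq> {}" "\<L> \<subseteq> P_ge d V" "H = (\<Union>L\<in>\<L>. Bd d V L)"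
      by blast
    then obtain H' where "BRSC (V, H')" "H = H' \<inter> P_le (d + 1) V"
      using BRSC_of_family[OF V d] by metis
    \<comment> \<open>The truncation at \<open>d + 1\<close> cuts off the larger faces that the
      matrix may produce.\<close>
    then have "BRSC (V, H') \<and> d + 1 \<ge> 1 \<and> (V, H) = truncation (d + 1) (V, H')"
      by simp
    then have "TBRSC (V, H)"
      unfolding TBRSC_def by blast
    then show "(V, H) \<in> TBPav d"
      unfolding TBPav_def using assms(2-4) by blast
  }
qed

end
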